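(* Let $\Gamma$ be an s-theory. If every finite subset of $\Gamma$ is satisfiable (i.e. satisfied by some frame), then $\Gamma$ is satisfiable (i.e. there is a single frame that satisfies every s-formula in $\Gamma$).
   Context: Fix an infinite (possibly uncountable) set $\Sigma$ of propositional variables. Propositional formulas are built from $\Sigma$ using $\lnot$, $\land$, $\lor$, $\to$. An s-formula is an expression of the form $A \prec B$ (a strict implication) or $A \not\prec B$ (a strict nonimplication), where $A$ and $B$ are propositional formulas; here $\prec$ and $\not\prec$ are two formal symbols, and they are not nested. An s-theory is an arbitrary (possibly infinite) set of s-formulas. A valuation is a function $w:\Sigma\to\{T,F\}$, extended in the usual way to all propositional formulas. A frame is a nonempty set of valuations. A frame $R$ satisfies $A \prec B$ if for every $w\in R$, $w(A\to B)=T$ (equivalently $w(A)=F$ or $w(B)=T$). A frame $R$ satisfies $A\not\prec B$ if there is at least one $w\in R$ with $w(A)=T$ and $w(B)=F$. A frame satisfies an s-theory if it satisfies every formula in it; an s-theory is satisfiable if some frame satisfies it. *)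

theory Defs
  imports Main
begin

datatype 'v form =
    Var 'v
  | Neg "'v form"
  | Conj "'v form" "'v form"
  | Disj "'v form" "'v form"
  | Imp "'v form" "'v form"

datatype 'v sform =
    Strict_Imp "'v form" "'v form"
  | Strict_Nonimp "'v form" "'v form"

type_synonym 'v stheory = "'v sform set"

type_synonym 'v valuation = "'v \<Rightarrow> bool"

primrec eval :: "'v valuation \<Rightarrow> 'v form \<Rightarrow> bool" where
  "eval w (Var p) \<longleftrightarrow> w p"
| "eval w (Neg A) \<longleftrightarrow> \<not> eval w A"
| "eval w (Conj A B) \<longleftrightarrow> eval w A \<and> eval w B"
| "eval w (Disj A B) \<longleftrightarrow> eval w A \<or> eval w B"
| "eval w (Imp A B) \<longleftrightarrow> (eval w A \<longrightarrow> eval w B)"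

definition frame :: "'v valuation set \<Rightarrow> bool" where
  "frame R \<longleftrightarrow> R \<noteq> {}"

primrec satisfies :: "'v valuation set \<Rightarrow> 'v sform \<Rightarrow> bool" where
  "satisfies R (Strict_Imp A B) \<longleftrightarrow> (\<forall>w\<in>R. eval w (Imp A B))"
| "satisfies R (Strict_Nonimp A B) \<longleftrightarrow> (\<exists>w\<in>R. eval w A \<and> \<not> eval w B)"

definition satisfies_theory :: "'v valuation set \<Rightarrow> 'v stheory \<Rightarrow> bool" where
  "satisfies_theory R \<Gamma> \<longleftrightarrow> (\<forall>\<phi>\<in>\<Gamma>. satisfies R \<phi>)"

definition satisfiable :: "'v stheory \<Rightarrow> bool" where
  "satisfiable \<Gamma> \<longleftrightarrow> (\<exists>R. frame R \<and> satisfies_theory R \<Gamma>)"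

end

theory Submission
  imports Defs
begin

text \<open>
  The strict implications of \<open>\<Gamma>\<close> only constrain individual valuations, so among the frames
  satisfying them there is a largest one: all common models of the formulas \<open>A \<rightarrow> B\<close> with
  \<open>A \<prec> B\<close> in \<open>\<Gamma>\<close>. Compactness of classical propositional logic shows that it is nonempty and,
  applied to these formulas together with \<open>A\<close> and \<open>\<not> B\<close>, that it contains a witness for each
  strict nonimplication \<open>A \<not>\<prec> B\<close> of \<open>\<Gamma>\<close>.
\<close>

definition finitely_satisfiable :: "'v form set \<Rightarrow> bool" where
  "finitely_satisfiable F \<longleftrightarrow> (\<forall>D\<subseteq>F. finite D \<longrightarrow> (\<exists>w. \<forall>A\<in>D. eval w A))"

lemma eval_cong:
  "(\<And>p. p \<in> set_form A \<Longrightarrow> v p = w p) \<Longrightarrow> eval v A = eval w A"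
  by (induction A) auto

lemma finite_set_form: "finite (set_form A)"
  by (induction A) auto

text \<open>If both extensions failed, there would be finite unsatisfiable sets \<open>D\<close> and
  \<open>E\<close>. Without \<open>A\<close> and \<open>Neg A\<close> respectively, their union is a
  finite subset of \<open>F\<close>, and a model of it would have to falsify both \<open>A\<close>
  and \<open>Neg A\<close>.\<close>

lemma finitely_satisfiable_insert_or_Neg:
  assumes "finitely_satisfiable F"
  shows "finitely_satisfiable (insert A F) \<or> finitely_satisfiable (insert (Neg A) F)"
proof (rule ccontr)
  assume "\<not> ?thesis"
  then have "\<not> finitely_satisfiable (insert A F)" "\<not> finitely_satisfiable (insert (Neg A) F)"
    by simp_all
  then obtain D E where D: "D \<subseteq> insert A F" "finite D" "\<forall>w. \<exists>B\<in>D. \<not> eval w B"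
    and E: "E \<subseteq> insert (Neg A) F" "finite E" "\<forall>w. \<exists>B\<in>E. \<not> eval w B"
    by (auto simp: finitely_satisfiable_def)
  have "(D - {A}) \<union> (E - {Neg A}) \<subseteq> F" "finite ((D - {A}) \<union> (E - {Neg A}))"
    using D(1,2) E(1,2) by blast+
  then obtain w where w: "\<forall>B\<in>(D - {A}) \<union> (E - {Neg A}). eval w B"
    using assms unfolding finitely_satisfiable_def by meson
  obtain B where "B \<in> D" "\<not> eval w B"
    using D(3) by blast
  with w have "\<not> eval w A"
    by (cases "B = A") simp_all
  moreover obtain C where "C \<in> E" "\<not> eval w C"
    using E(3) by blast
  with w have "\<not> eval w (Neg A)"
    by (cases "C = Neg A") simp_all
  ultimately show False
    by simp
qed

text \<open>A finite subset of the union of a nonempty chain already lies in one member. This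
  supplies the upper bounds for Zorn's lemma.\<close>

lemma finitely_satisfiable_Union_chain:
  assumes "subset.chain {F. finitely_satisfiable F} \<C>" and "\<C> \<noteq> {}"
  shows "finitely_satisfiable (\<Union>\<C>)"
  unfolding finitely_satisfiable_def
proof (intro allI impI)
  fix D assume "D \<subseteq> \<Union>\<C>" "finite D"
  then obtain F where "F \<in> \<C>" "D \<subseteq> F"
    using finite_subset_Union_chain[OF _ _ assms(2,1)] by metis
  moreover have "finitely_satisfiable F"
    using assms(1) \<open>F \<in> \<C>\<close> unfolding subset.chain_def by auto
  ultimately show "\<exists>w. \<forall>A\<in>D. eval w A"
    using \<open>finite D\<close> unfolding finitely_satisfiable_def by blast
qed

text \<open>Lindenbaum's argument: a maximal finitely satisfiable \<open>M\<close> containing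
  \<open>F\<close> decides every formula, and the variables in \<open>M\<close> form a valuation
  satisfying all of \<open>M\<close>.\<close>

theorem propositional_compactness:
  assumes "finitely_satisfiable F"
  obtains w where "\<And>A. A \<in> F \<Longrightarrow> eval w A"
proof -
  let ?\<A> = "{M. finitely_satisfiable M \<and> F \<subseteq> M}"
  have "\<exists>M\<in>?\<A>. \<forall>X\<in>?\<A>. M \<subseteq> X \<longrightarrow> X = M"
  proof (rule subset_Zorn_nonempty)
    show "?\<A> \<noteq> {}"
      using assms by blast
    fix \<C> assume \<C>: "\<C> \<noteq> {}" "subset.chain ?\<A> \<C>"
    then have "subset.chain {M. finitely_satisfiable M} \<C>"
      unfolding subset.chain_def by blast
    with \<C> have "finitely_satisfiable (\<Union>\<C>)"
      using finitely_satisfiable_Union_chain by blast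
    moreover have "F \<subseteq> \<Union>\<C>"
      using \<C> unfolding subset.chain_def by blast
    ultimately show "\<Union>\<C> \<in> ?\<A>"
      by blast
  qed
  then obtain M where M: "finitely_satisfiable M" "F \<subseteq> M"
    and "\<forall>X\<in>?\<A>. M \<subseteq> X \<longrightarrow> X = M"
    by blast
  then have max: "X = M" if "finitely_satisfiable X" "M \<subseteq> X" for X
    using that by blast
  \<comment> \<open>One of the two extensions of \<open>M\<close> is finitely satisfiable, so by
    maximality it equals \<open>M\<close>.\<close>
  have complete: "A \<in> M \<or> Neg A \<in> M" for A
    using finitely_satisfiable_insert_or_Neg[OF M(1), of A]
      max[of "insert A M"] max[of "insert (Neg A) M"] by blast
  define w where "w = (\<lambda>p. Var p \<in> M)"
  have "eval w A" if "A \<in> M" for A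
  proof -
    \<comment> \<open>The literals that \<open>M\<close> contains for the finitely many variables of
      \<open>A\<close> force any model \<open>v\<close> of them to agree with \<open>w\<close>
      there. Finite satisfiability gives such a \<open>v\<close> that also satisfies
      \<open>A\<close>.\<close>
    define lit where "lit = (\<lambda>p. if Var p \<in> M then Var p else Neg (Var p))"
    have "insert A (lit ` set_form A) \<subseteq> M"
      using that complete by (auto simp: lit_def)
    moreover have "finite (insert A (lit ` set_form A))"
      by (simp add: finite_set_form)
    ultimately obtain v where v: "\<forall>B\<in>insert A (lit ` set_form A). eval v B"
      using M(1) unfolding finitely_satisfiable_def by meson
    have "v p = w p" if "p \<in> set_form A" for p
    proof -
      have "eval v (lit p)"
        using v that by blast
      then show ?thesis
        by (auto simp: lit_def w_def split: if_splits)
    qed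
    then show ?thesis
      using v eval_cong[of A v w] by blast
  qed
  with M(2) that show thesis
    by blast
qed

definition implications :: "'v stheory \<Rightarrow> 'v form set" where
  "implications \<Gamma> = {Imp A B |A B. Strict_Imp A B \<in> \<Gamma>}"

text \<open>This passes from finite sets of formulas, which compactness is about, to finite
  subtheories, which the hypothesis on \<open>\<Gamma>\<close> is about.\<close>

lemma finite_subset_implications:
  assumes "finite D" "D \<subseteq> implications \<Gamma>"
  obtains \<Delta> where "\<Delta> \<subseteq> \<Gamma>" "finite \<Delta>" "D \<subseteq> implications \<Delta>"
proof -
  \<comment> \<open>Written as an image, the set lets a finite \<open>D\<close> be pulled back to a
    finite set \<open>P\<close> of pairs.\<close>
  have "implications \<Gamma> = case_prod Imp ` {(A, B). Strict_Imp A B \<in> \<Gamma>}"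
    by (auto simp: implications_def)
  then obtain P where P: "P \<subseteq> {(A, B). Strict_Imp A B \<in> \<Gamma>}" "finite P" "D = case_prod Imp ` P"
    using finite_subset_image[OF assms(1)] assms(2) by metis
  show thesis
    by (rule that[of "case_prod Strict_Imp ` P"]) (use P in \<open>auto simp: implications_def\<close>)
qed

lemma satisfies_implications:
  assumes "satisfies_theory R \<Delta>" "w \<in> R" "A \<in> implications \<Delta>"
  shows "eval w A"
  using assms unfolding satisfies_theory_def implications_def by fastforce

theorem theorem4:
  fixes \<Gamma> :: "'v stheory"
  assumes "infinite (UNIV :: 'v set)"
    and "\<And>\<Delta>. \<Delta> \<subseteq> \<Gamma> \<Longrightarrow> finite \<Delta> \<Longrightarrow> satisfiable \<Delta>"
  shows "satisfiable \<Gamma>"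
proof -
  define R where "R = {w. \<forall>A\<in>implications \<Gamma>. eval w A}"
  have "finitely_satisfiable (implications \<Gamma>)"
    unfolding finitely_satisfiable_def
  proof (intro allI impI)
    fix D assume "D \<subseteq> implications \<Gamma>" "finite D"
    then obtain \<Delta> where \<Delta>: "\<Delta> \<subseteq> \<Gamma>" "finite \<Delta>" "D \<subseteq> implications \<Delta>"
      using finite_subset_implications[of D \<Gamma>] by blast
    \<comment> \<open>Any point of a frame for \<open>\<Delta>\<close> will do, and frames are
      nonempty.\<close>
    obtain S w where "satisfies_theory S \<Delta>" "w \<in> S"
      using assms(2)[OF \<Delta>(1,2)] unfolding satisfiable_def frame_def by blast
    with \<Delta>(3) show "\<exists>w. \<forall>A\<in>D. eval w A"
      using satisfies_implications by blast
  qed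
  then have "frame R"
    unfolding frame_def R_def by (rule propositional_compactness) blast
  moreover have "\<exists>w\<in>R. eval w A \<and> \<not> eval w B" if nonimp: "Strict_Nonimp A B \<in> \<Gamma>" for A B
  proof -
    have "finitely_satisfiable (implications \<Gamma> \<union> {A, Neg B})"
      unfolding finitely_satisfiable_def
    proof (intro allI impI)
      fix D assume D: "D \<subseteq> implications \<Gamma> \<union> {A, Neg B}" "finite D"
      have "finite (D - {A, Neg B})" "D - {A, Neg B} \<subseteq> implications \<Gamma>"
        using D by auto
      then obtain \<Delta> where \<Delta>: "\<Delta> \<subseteq> \<Gamma>" "finite \<Delta>" "D - {A, Neg B} \<subseteq> implications \<Delta>"
        using finite_subset_implications[of "D - {A, Neg B}" \<Gamma>] by blast
      \<comment> \<open>The added nonimplication yields a point of \<open>S\<close> where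
        \<open>A\<close> holds and \<open>B\<close> fails. The strict implications in
        \<open>\<Delta>\<close> bind every point of \<open>S\<close>, so this one satisfies all of
        \<open>D\<close>.\<close>
      obtain S where S: "satisfies_theory S (insert (Strict_Nonimp A B) \<Delta>)"
        using assms(2)[of "insert (Strict_Nonimp A B) \<Delta>"] \<Delta>(1,2) nonimp
        unfolding satisfiable_def by auto
      then obtain w where w: "w \<in> S" "eval w A" "\<not> eval w B"
        unfolding satisfies_theory_def by auto
      have "satisfies_theory S \<Delta>"
        using S unfolding satisfies_theory_def by blast
      then have "eval w C" if "C \<in> implications \<Delta>" for C
        using satisfies_implications w(1) that by blast
      with \<Delta>(3) w(2,3) show "\<exists>w. \<forall>C\<in>D. eval w C"
        by (intro exI[of _ w]) auto
    qed
    then obtain w where w: "\<And>C. C \<in> implications \<Gamma> \<union> {A, Neg B} \<Longrightarrow> eval w C"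
      using propositional_compactness by blast
    then have "w \<in> R"
      unfolding R_def by blast
    moreover have "eval w A" "\<not> eval w B"
      using w[of A] w[of "Neg B"] by simp_all
    ultimately show ?thesis
      by blast
  qed
  moreover have "eval w (Imp A B)" if "Strict_Imp A B \<in> \<Gamma>" "w \<in> R" for A B w
    using that unfolding R_def implications_def by blast
  ultimately have "satisfies R \<phi>" if "\<phi> \<in> \<Gamma>" for \<phi>
    using that by (cases \<phi>) auto
  with \<open>frame R\<close> show ?thesis
    unfolding satisfiable_def satisfies_theory_def by blast
qed

end
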